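(* Let $l>0$ be known, $n_0>0$ and $\mu_0>l$. Let $X=(x_1,\dots,x_n)$, $n\ge1$, be observations with $x_i>l$ that are i.i.d. given $\alpha>0$, each with the shifted exponential density $p(x_i\mid\alpha)=\mathrm{Exp}(x_i\mid\alpha,l)$. Suppose $\alpha$ has prior distribution $\Gamma(n_0,\ n_0(\mu_0-l))$. Let $\hat\mu=\frac1n\sum_{i=1}^n x_i$ and $\mu_n=\frac{n\hat\mu+n_0\mu_0}{n+n_0}$. Then the posterior distribution of $\alpha$ is $$p(\alpha\mid X)=\Gamma\big(\alpha\mid n+n_0,\ (n+n_0)(\mu_n-l)\big).$$ Moreover, with $A=n+n_0$ and $B=(n+n_0)(\mu_n-l)$, the predictive density of a new observation $x$ is $$p(x\mid X)=\frac{A B^{A}}{(B+x-l)^{A+1}}\qquad(x>l),$$ i.e. conditionally on $X$ the random variable $x+B-l$ has distribution $\mathrm{Pareto}(A,B)$.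
   Context: For $\alpha>0$, $\mathrm{Exp}(x\mid\alpha,l)=\alpha e^{-\alpha(x-l)}$ for $x>l$ and $0$ otherwise. $\Gamma(a,b)$ (with $a,b>0$) is the Gamma distribution with shape $a$ and rate $b$: density $\Gamma(\alpha\mid a,b)=\frac{b^a}{\Gamma(a)}\alpha^{a-1}e^{-b\alpha}$ for $\alpha>0$. $\mathrm{Pareto}(a,b)$ (with $a,b>0$) has density $\frac{a b^{a}}{y^{a+1}}$ for $y>b$ and $0$ otherwise. The posterior is $p(\alpha\mid X)=p(X\mid\alpha)p(\alpha)\big/\int_0^\infty p(X\mid\alpha)p(\alpha)\,d\alpha$ with $p(X\mid\alpha)=\prod_i p(x_i\mid\alpha)$. The predictive density is $p(x\mid X)=\int_0^\infty p(x\mid\alpha)p(\alpha\mid X)\,d\alpha$. *)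

theory Defs
  imports "HOL-Probability.Probability"
begin

text \<open>
  The library's \<^const>\<open>exponential_density\<close> and \<^const>\<open>erlang_density\<close> do not cover the
  densities below: the support here is the open half-line, shifted by \<open>l\<close>, and the
  shape of the Gamma distribution is a real number.
\<close>

definition shifted_exp_density :: "real \<Rightarrow> real \<Rightarrow> real \<Rightarrow> real" where
  "shifted_exp_density \<alpha> l x = (if x > l then \<alpha> * exp (- \<alpha> * (x - l)) else 0)"

definition gamma_density :: "real \<Rightarrow> real \<Rightarrow> real \<Rightarrow> real" where
  "gamma_density a b \<alpha> =
     (if \<alpha> > 0 then b powr a / Gamma a * \<alpha> powr (a - 1) * exp (- b * \<alpha>) else 0)"

definition pareto_density :: "real \<Rightarrow> real \<Rightarrow> real \<Rightarrow> real" where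
  "pareto_density a b y = (if y > b then a * b powr a / y powr (a + 1) else 0)"

text \<open>
  Bayesian inference for a parameter in \<open>(0, \<infinity>)\<close>: \<open>p \<alpha> x\<close> is the sampling density of a
  single observation \<open>x\<close> given the parameter \<open>\<alpha>\<close>, \<open>\<pi>\<close> is the prior density, and the data are
  \<open>x 1, \<dots>, x n\<close>. The observations being i.i.d. given \<open>\<alpha>\<close> is the product form of the likelihood.
\<close>

definition likelihood :: "(real \<Rightarrow> real \<Rightarrow> real) \<Rightarrow> nat \<Rightarrow> (nat \<Rightarrow> real) \<Rightarrow> real \<Rightarrow> real" where
  "likelihood p n x \<alpha> = (\<Prod>i = 1..n. p \<alpha> (x i))"

definition posterior_density ::
  "(real \<Rightarrow> real \<Rightarrow> real) \<Rightarrow> (real \<Rightarrow> real) \<Rightarrow> nat \<Rightarrow> (nat \<Rightarrow> real) \<Rightarrow> real \<Rightarrow> real" where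
  "posterior_density p \<pi> n x \<alpha> =
     likelihood p n x \<alpha> * \<pi> \<alpha> / (LBINT \<beta>:{0<..}. likelihood p n x \<beta> * \<pi> \<beta>)"

definition predictive_density ::
  "(real \<Rightarrow> real \<Rightarrow> real) \<Rightarrow> (real \<Rightarrow> real) \<Rightarrow> nat \<Rightarrow> (nat \<Rightarrow> real) \<Rightarrow> real \<Rightarrow> real" where
  "predictive_density p \<pi> n x y =
     (LBINT \<alpha>:{0<..}. p \<alpha> y * posterior_density p \<pi> n x \<alpha>)"

end

(* Multiplying a Gamma density by one shifted exponential factor gives a constant multiple of
   another Gamma density. Applied to the data one observation at a time this identifies the
   posterior, the constants cancelling against the evidence; applied once more, to a new
   observation, the constant itself is the predictive density. *)
theory Submission
  imports Defs
begin

text \<open>This is Euler's integral for \<open>Gamma a\<close> after the substitution of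
  \<open>b * t\<close> for the variable, whose Jacobian contributes the factor \<open>b\<close>.
  Starting from the nonnegative integral gives integrability together with the value.\<close>

lemma has_bochner_integral_gamma_density:
  assumes "a > 0" and "b > 0"
  shows "has_bochner_integral lborel (gamma_density a b) 1"
proof -
  have pos: "Gamma a > 0"
    using assms by (rule_tac Gamma_real_pos)
  have "has_bochner_integral lborel (\<lambda>t. indicator {0..} t * t powr (a - 1) / exp t) (Gamma a)"
    using Gamma_conv_nn_integral_real[OF \<open>a > 0\<close>] pos
    by (intro has_bochner_integral_nn_integral) auto
  then have "has_bochner_integral lborel
      (\<lambda>t. indicator {0..} (0 + b * t) * (0 + b * t) powr (a - 1) / exp (0 + b * t))
      (Gamma a /\<^sub>R \<bar>b\<bar>)"
    using assms by (subst (asm) lborel_has_bochner_integral_real_affine_iff[where c = b and t = 0]) auto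
  from has_bochner_integral_mult_right[OF this, of "b / Gamma a"]
  have "has_bochner_integral lborel (\<lambda>t. b / Gamma a *
      (indicator {0..} (0 + b * t) * (0 + b * t) powr (a - 1) / exp (0 + b * t))) 1"
    using assms pos by (simp add: field_simps)
  \<comment> \<open>The two functions agree even at \<open>t = 0\<close>, where the indicator of
    \<open>{0..}\<close> is 1 but \<open>gamma_density\<close> is 0 by definition: there
    \<open>0 powr (a - 1) = 0\<close>.\<close>
  moreover have "(\<lambda>t. b / Gamma a *
      (indicator {0..} (0 + b * t) * (0 + b * t) powr (a - 1) / exp (0 + b * t))) = gamma_density a b"
  proof
    fix t
    have "b powr a = b * b powr (a - 1)"
      using assms by (simp add: powr_mult_base)
    then show "b / Gamma a *
      (indicator {0..} (0 + b * t) * (0 + b * t) powr (a - 1) / exp (0 + b * t)) = gamma_density a b t"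
      using assms by (auto simp: gamma_density_def indicator_def powr_mult exp_minus divide_inverse
          zero_le_mult_iff)
  qed
  ultimately show ?thesis by simp
qed

lemma set_integral_gamma_density:
  assumes "a > 0" and "b > 0"
  shows "(LBINT t:{0<..}. gamma_density a b t) = 1"
proof -
  have "(LBINT t:{0<..}. gamma_density a b t) = (LBINT t. gamma_density a b t)"
    unfolding set_lebesgue_integral_def
    by (rule Bochner_Integration.integral_cong) (auto simp: gamma_density_def indicator_def)
  then show ?thesis
    using has_bochner_integral_integral_eq[OF has_bochner_integral_gamma_density[OF assms]] by simp
qed

text \<open>The factor \<alpha> raises the shape by one and the two exponentials merge into one with
  rate \<open>b + y - l\<close>. The constant is the quotient of the normalizing constants, where
  \<open>Gamma (a + 1) = a * Gamma a\<close> leaves the factor \<open>a\<close>.\<close>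

lemma shifted_exp_mult_gamma_density:
  assumes "a > 0" and "b > 0" and "y > l"
  shows "shifted_exp_density \<alpha> l y * gamma_density a b \<alpha> =
    a * b powr a / (b + y - l) powr (a + 1) * gamma_density (a + 1) (b + y - l) \<alpha>"
proof (cases "\<alpha> > 0")
  case True
  have "\<alpha> powr a = \<alpha> * \<alpha> powr (a - 1)"
    using True by (simp add: powr_mult_base)
  moreover have "Gamma (a + 1) = a * Gamma a"
    using assms by (intro Gamma_plus1) (auto elim!: nonpos_Ints_cases)
  moreover have "exp (- (b + y - l) * \<alpha>) = exp (- \<alpha> * (y - l)) * exp (- b * \<alpha>)"
    by (simp add: algebra_simps flip: exp_add)
  moreover have "(b + y - l) powr (a + 1) > 0"
    using assms by simp
  ultimately show ?thesis
    using True assms by (simp add: shifted_exp_density_def gamma_density_def)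
qed (simp add: gamma_density_def)

text \<open>The constant stays unspecified because normalization removes it; only its independence
  of \<alpha> and its being nonzero matter later.\<close>

lemma likelihood_mult_gamma_density:
  assumes "a > 0" and "b > 0" and "\<And>i. i \<in> {1..n} \<Longrightarrow> x i > l"
  obtains C where "C > 0" and
    "\<And>\<alpha>. likelihood (\<lambda>\<alpha>. shifted_exp_density \<alpha> l) n x \<alpha> * gamma_density a b \<alpha> =
      C * gamma_density (a + real n) (b + (\<Sum>i = 1..n. x i - l)) \<alpha>"
proof -
  have "\<exists>C>0. \<forall>\<alpha>. likelihood (\<lambda>\<alpha>. shifted_exp_density \<alpha> l) n x \<alpha> * gamma_density a b \<alpha> =
      C * gamma_density (a + real n) (b + (\<Sum>i = 1..n. x i - l)) \<alpha>"
    using assms(3)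
  proof (induction n)
    case 0
    show ?case by (auto simp: likelihood_def intro!: exI[of _ 1])
  next
    case (Suc n)
    let ?a = "a + real n" and ?b = "b + (\<Sum>i = 1..n. x i - l)" and ?y = "x (Suc n)"
    obtain C where C: "C > 0" "\<And>\<alpha>. likelihood (\<lambda>\<alpha>. shifted_exp_density \<alpha> l) n x \<alpha>
        * gamma_density a b \<alpha> = C * gamma_density ?a ?b \<alpha>"
      using Suc by force
    have "(\<Sum>i = 1..n. x i - l) \<ge> 0"
      using Suc.prems by (intro sum_nonneg) (simp add: less_imp_le)
    then have pos: "?a > 0" "?b > 0" "?y > l"
      using assms Suc.prems by auto
    \<comment> \<open>The constant of \<open>shifted_exp_mult_gamma_density\<close> at the
      parameters reached after \<open>n\<close> observations.\<close>
    define D where "D = ?a * ?b powr ?a / (?b + ?y - l) powr (?a + 1)"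
    have "likelihood (\<lambda>\<alpha>. shifted_exp_density \<alpha> l) (Suc n) x \<alpha> * gamma_density a b \<alpha> =
        C * D * gamma_density (a + real (Suc n)) (b + (\<Sum>i = 1..Suc n. x i - l)) \<alpha>" for \<alpha>
    proof -
      have "likelihood (\<lambda>\<alpha>. shifted_exp_density \<alpha> l) (Suc n) x \<alpha> * gamma_density a b \<alpha> =
          shifted_exp_density \<alpha> l ?y * (C * gamma_density ?a ?b \<alpha>)"
        unfolding C(2)[symmetric] by (simp add: likelihood_def)
      also have "\<dots> = C * (shifted_exp_density \<alpha> l ?y * gamma_density ?a ?b \<alpha>)"
        by simp
      also have "\<dots> = C * D * gamma_density (?a + 1) (?b + ?y - l) \<alpha>"
        unfolding shifted_exp_mult_gamma_density[OF pos] D_def by simp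
      finally show ?thesis by (simp add: algebra_simps)
    qed
    moreover have "C * D > 0"
      using C(1) pos by (auto simp: D_def intro!: mult_pos_pos divide_pos_pos)
    ultimately show ?case by blast
  qed
  then show ?thesis using that by blast
qed

text \<open>Rewriting with \<open>C(2)\<close> changes numerator and evidence alike. The evidence
  becomes \<open>C\<close> times the total mass 1 of a Gamma density, so \<open>C\<close>
  cancels.\<close>

lemma posterior_density_gamma:
  assumes "a > 0" and "b > 0" and "\<And>i. i \<in> {1..n} \<Longrightarrow> x i > l"
  shows "posterior_density (\<lambda>\<alpha>. shifted_exp_density \<alpha> l) (gamma_density a b) n x =
    gamma_density (a + real n) (b + (\<Sum>i = 1..n. x i - l))"
proof -
  obtain C where C: "C > 0" "\<And>\<alpha>. likelihood (\<lambda>\<alpha>. shifted_exp_density \<alpha> l) n x \<alpha>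
      * gamma_density a b \<alpha> = C * gamma_density (a + real n) (b + (\<Sum>i = 1..n. x i - l)) \<alpha>"
    using likelihood_mult_gamma_density[where x = x and n = n and l = l, OF assms] by blast
  have "(\<Sum>i = 1..n. x i - l) \<ge> 0"
    using assms(3) by (intro sum_nonneg) (simp add: less_imp_le)
  then show ?thesis
    using assms C(1) unfolding posterior_density_def C(2)
    by (simp add: set_integral_gamma_density)
qed

text \<open>Translation invariance of Lebesgue measure: \<open>lborel\<close> is its own image under
  the shift, so the density can be pulled back through that image.\<close>

lemma distributed_translation:
  fixes f :: "real \<Rightarrow> ennreal"
  assumes [measurable]: "f \<in> borel_measurable borel"
  shows "distributed (density lborel (\<lambda>y. f (c + y))) lborel (\<lambda>y. c + y) f"
proof -
  have "density lborel f = density (distr lborel borel ((+) c)) f"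
    by (simp add: lborel_distr_plus)
  also have "\<dots> = distr (density lborel (\<lambda>y. f (c + y))) borel ((+) c)"
    by (rule density_distr) auto
  \<comment> \<open>Only the target changes, from \<open>borel\<close> to \<open>lborel\<close>, as
    \<open>distributed\<close> demands; an image measure depends on its target only through the
    measurable sets, which coincide.\<close>
  also have "\<dots> = distr (density lborel (\<lambda>y. f (c + y))) lborel ((+) c)"
    by (rule distr_cong) auto
  finally show ?thesis
    by (simp add: distributed_def)
qed

theorem mainTheorem2:
  fixes l n\<^sub>0 \<mu>\<^sub>0 \<mu>_hat \<mu>\<^sub>n A B :: real
    and n :: nat and x :: "nat \<Rightarrow> real"
    and p :: "real \<Rightarrow> real \<Rightarrow> real" and \<pi> :: "real \<Rightarrow> real"
  assumes "l > 0" and "n\<^sub>0 > 0" and "\<mu>\<^sub>0 > l"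
    and "n \<ge> 1" and "\<And>i. i \<in> {1..n} \<Longrightarrow> x i > l"
    and p: "p = (\<lambda>\<alpha>. shifted_exp_density \<alpha> l)"
    and \<pi>: "\<pi> = gamma_density n\<^sub>0 (n\<^sub>0 * (\<mu>\<^sub>0 - l))"
    and "\<mu>_hat = 1 / real n * (\<Sum>i = 1..n. x i)"
    and "\<mu>\<^sub>n = (real n * \<mu>_hat + n\<^sub>0 * \<mu>\<^sub>0) / (real n + n\<^sub>0)"
    and "A = real n + n\<^sub>0" and "B = (real n + n\<^sub>0) * (\<mu>\<^sub>n - l)"
  shows "(\<forall>\<alpha>. posterior_density p \<pi> n x \<alpha>
                = gamma_density (real n + n\<^sub>0) ((real n + n\<^sub>0) * (\<mu>\<^sub>n - l)) \<alpha>)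
    \<and> (\<forall>y > l. predictive_density p \<pi> n x y = A * B powr A / (B + y - l) powr (A + 1))
    \<and> distributed (density lborel (\<lambda>y. ennreal (predictive_density p \<pi> n x y)))
         lborel (\<lambda>y. y + B - l) (\<lambda>z. ennreal (pareto_density A B z))"
proof -
  \<comment> \<open>The cancellation of \<open>1 / real n\<close> rests on
    \<open>n \<ge> 1\<close>.\<close>
  have "real n * \<mu>_hat = (\<Sum>i = 1..n. x i)"
    using assms by simp
  moreover have "real n + n\<^sub>0 > 0"
    using assms by simp
  \<comment> \<open>This turns \<open>B\<close> into the prior rate plus the sum of the excesses
    over \<open>l\<close>, the form in which \<open>posterior_density_gamma\<close> gives the rate
    and from which \<open>B > 0\<close> is evident.\<close>
  ultimately have B: "B = n\<^sub>0 * (\<mu>\<^sub>0 - l) + (\<Sum>i = 1..n. x i - l)"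
    using assms by (simp add: sum_subtractf field_simps)
  have "(\<Sum>i = 1..n. x i - l) \<ge> 0"
    using assms(5) by (intro sum_nonneg) (simp add: less_imp_le)
  moreover have "n\<^sub>0 * (\<mu>\<^sub>0 - l) > 0"
    using assms by simp
  ultimately have "A > 0" "B > 0"
    using assms(2,10) by (simp_all add: B)
  have posterior: "posterior_density p \<pi> n x = gamma_density A B"
    unfolding p \<pi> B \<open>A = real n + n\<^sub>0\<close> using assms
    by (subst posterior_density_gamma) (auto simp: add.commute)
  have predictive: "predictive_density p \<pi> n x y = A * B powr A / (B + y - l) powr (A + 1)"
    if "y > l" for y
    unfolding predictive_density_def posterior unfolding p
    using \<open>A > 0\<close> \<open>B > 0\<close> that
    by (simp add: shifted_exp_mult_gamma_density set_integral_gamma_density)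
  \<comment> \<open>The shift by \<open>B - l\<close> carries the threshold \<open>l\<close> to
    \<open>B\<close>, so both sides vanish for \<open>y \<le> l\<close>, the left one because the
    sampling density at \<open>y\<close> is zero for every \<alpha>.\<close>
  have "predictive_density p \<pi> n x y = pareto_density A B (B - l + y)" for y
  proof (cases "y > l")
    case True
    then show ?thesis
      by (simp add: predictive pareto_density_def algebra_simps)
  next
    case False
    then show ?thesis
      by (simp add: predictive_density_def p shifted_exp_density_def pareto_density_def)
  qed
  moreover have "(\<lambda>z. ennreal (pareto_density A B z)) \<in> borel_measurable borel"
    unfolding pareto_density_def by measurable
  from distributed_translation[OF this, of "B - l"]
  have "distributed (density lborel (\<lambda>y. ennreal (pareto_density A B (B - l + y)))) lborel
      (\<lambda>y. y + B - l) (\<lambda>z. ennreal (pareto_density A B z))"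
    by (simp add: algebra_simps)
  ultimately show ?thesis
    using posterior predictive \<open>A = real n + n\<^sub>0\<close> \<open>B = (real n + n\<^sub>0) * (\<mu>\<^sub>n - l)\<close> by simp
qed

end
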